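(* Let $g$ and $m$ be two Riemannian metrics on a smooth manifold $M$, and let $v^a$ be a smooth vector field. Then $$v^{a}_{;b}(m) = v^{a}_{;b}(g)+\Gamma^{a}_{cb}(g,m)\, v^{c}.$$
   Context: Indices refer to components in a local coordinate chart, and repeated indices are summed. For a Riemannian metric $g$, a semicolon followed by an index denotes covariant differentiation with respect to the Levi-Civita connection of a metric. The first metric in the parameter list of an expression specifies which connection is used. So $v^a_{;b}(g)$ is the covariant derivative of $v^a$ with respect to the Levi-Civita connection of $g$, and $v^a_{;b}(m)$ is the one with respect to the Levi-Civita connection of $m$. For two metrics $g,m$ define $$\Gamma^{a}_{bc}(g,m) = \tfrac{1}{2}\, m^{an}\left(m_{nb;c}+m_{nc;b}-m_{bc;n}\right),$$ where $m^{an}$ is the inverse of $m_{an}$ and the semicolons denote covariant derivatives with respect to the Levi-Civita connection of $g$ (the first parameter). *)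

theory Defs
  imports "HOL-Analysis.Analysis"
begin

definition partial :: "'n::finite \<Rightarrow> (real ^ 'n \<Rightarrow> real) \<Rightarrow> real ^ 'n \<Rightarrow> real"
  where "partial i f x = frechet_derivative f (at x) (axis i 1)"

primrec Ck_on :: "nat \<Rightarrow> 'a::real_normed_vector set \<Rightarrow> ('a \<Rightarrow> 'b::real_normed_vector) \<Rightarrow> bool"
  where
    "Ck_on 0 S f \<longleftrightarrow> continuous_on S f"
  | "Ck_on (Suc k) S f \<longleftrightarrow>
       (\<forall>x\<in>S. f differentiable (at x)) \<and>
       (\<forall>u. Ck_on k S (\<lambda>x. frechet_derivative f (at x) u))"

text \<open>Only used for open \<open>S\<close>, since the derivatives are two-sided.\<close>

definition smooth_on :: "'a::real_normed_vector set \<Rightarrow> ('a \<Rightarrow> 'b::real_normed_vector) \<Rightarrow> bool"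
  where "smooth_on S f \<longleftrightarrow> (\<forall>k. Ck_on k S f)"

text \<open>A chart is a coordinate domain together with its coordinate map; the values of the map
  outside the domain are irrelevant. The dimension is \<open>CARD('n)\<close>.\<close>

type_synonym ('p, 'n) chart = "'p set \<times> ('p \<Rightarrow> real ^ 'n)"

definition chart_image :: "('p, 'n::finite) chart \<Rightarrow> (real ^ 'n) set"
  where "chart_image c = snd c ` fst c"

definition overlap :: "('p, 'n::finite) chart \<Rightarrow> ('p, 'n) chart \<Rightarrow> (real ^ 'n) set"
  where "overlap c c' = snd c ` (fst c \<inter> fst c')"

definition transition :: "('p, 'n::finite) chart \<Rightarrow> ('p, 'n) chart \<Rightarrow> real ^ 'n \<Rightarrow> real ^ 'n"
  where "transition c c' x = snd c' (inv_into (fst c) (snd c) x)"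

text \<open>The atlas need not be maximal, but it may be: statements about all charts of an arbitrary
  smooth atlas cover all charts of the smooth structure it generates.\<close>

definition smooth_manifold :: "'p topology \<Rightarrow> ('p, 'n::finite) chart set \<Rightarrow> bool"
  where "smooth_manifold M A \<longleftrightarrow>
    Hausdorff_space M \<and> second_countable M \<and>
    (\<Union>c\<in>A. fst c) = topspace M \<and>
    (\<forall>c\<in>A. openin M (fst c) \<and> open (chart_image c) \<and>
       homeomorphic_map (subtopology M (fst c)) (top_of_set (chart_image c)) (snd c)) \<and>
    (\<forall>c\<in>A. \<forall>c'\<in>A. smooth_on (overlap c c') (transition c c'))"

text \<open>\<open>jac c c' x a i\<close> is the partial derivative of the \<open>a\<close>-th coordinate of \<open>c'\<close> with respect to the
  \<open>i\<close>-th coordinate of \<open>c\<close>, at the point whose coordinates in \<open>c\<close> are \<open>x\<close>.\<close>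

definition jac :: "('p, 'n::finite) chart \<Rightarrow> ('p, 'n) chart \<Rightarrow> real ^ 'n \<Rightarrow> 'n \<Rightarrow> 'n \<Rightarrow> real"
  where "jac c c' x a i = partial i (\<lambda>y. transition c c' y $ a) x"

text \<open>A field assigns to each chart its components as functions of the coordinates of that chart;
  only the values on \<^const>\<open>chart_image\<close> matter. The families belonging to different charts are
  tied together by the transformation laws.\<close>

type_synonym ('p, 'n) vfield = "('p, 'n) chart \<Rightarrow> real ^ 'n \<Rightarrow> real ^ 'n"
type_synonym ('p, 'n) tensor2 = "('p, 'n) chart \<Rightarrow> real ^ 'n \<Rightarrow> real ^ 'n ^ 'n"
type_synonym ('p, 'n) conn = "('p, 'n) chart \<Rightarrow> real ^ 'n \<Rightarrow> 'n \<Rightarrow> 'n \<Rightarrow> 'n \<Rightarrow> real"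

definition smooth_vector_field ::
    "('p, 'n::finite) chart set \<Rightarrow> ('p, 'n) vfield \<Rightarrow> bool"
  where "smooth_vector_field A v \<longleftrightarrow>
    (\<forall>c\<in>A. smooth_on (chart_image c) (v c)) \<and>
    (\<forall>c\<in>A. \<forall>c'\<in>A. \<forall>x\<in>overlap c c'. \<forall>a.
       v c' (transition c c' x) $ a = (\<Sum>i\<in>UNIV. jac c c' x a i * v c x $ i))"

definition riemannian_metric ::
    "('p, 'n::finite) chart set \<Rightarrow> ('p, 'n) tensor2 \<Rightarrow> bool"
  where "riemannian_metric A g \<longleftrightarrow>
    (\<forall>c\<in>A. smooth_on (chart_image c) (g c)) \<and>
    (\<forall>c\<in>A. \<forall>x\<in>chart_image c.
       (\<forall>a b. g c x $ a $ b = g c x $ b $ a) \<and>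
       (\<forall>u. u \<noteq> 0 \<longrightarrow> (\<Sum>a\<in>UNIV. \<Sum>b\<in>UNIV. g c x $ a $ b * u $ a * u $ b) > 0)) \<and>
    (\<forall>c\<in>A. \<forall>c'\<in>A. \<forall>x\<in>overlap c c'. \<forall>i j.
       g c x $ i $ j =
         (\<Sum>a\<in>UNIV. \<Sum>b\<in>UNIV. g c' (transition c c' x) $ a $ b * jac c c' x a i * jac c c' x b j))"

text \<open>An affine connection is given by its coefficients \<open>\<Gamma> c x a b d\<close> (upper index \<open>a\<close>, lower
  indices \<open>b\<close> and \<open>d\<close>), where the derivative of the \<open>d\<close>-th coordinate field in the direction of the
  \<open>b\<close>-th one has components \<open>\<Gamma> c x a b d\<close>. The change-of-chart law is the inhomogeneous one, with
  the second derivatives of the coordinate change.\<close>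

definition affine_connection ::
    "('p, 'n::finite) chart set \<Rightarrow> ('p, 'n) conn \<Rightarrow> bool"
  where "affine_connection A \<Gamma> \<longleftrightarrow>
    (\<forall>c\<in>A. \<forall>a b d. smooth_on (chart_image c) (\<lambda>x. \<Gamma> c x a b d)) \<and>
    (\<forall>c\<in>A. \<forall>c'\<in>A. \<forall>x\<in>overlap c c'. \<forall>a i j.
       (\<Sum>k\<in>UNIV. jac c c' x a k * \<Gamma> c x k i j) =
         partial i (\<lambda>y. jac c c' y a j) x +
         (\<Sum>b\<in>UNIV. \<Sum>d\<in>UNIV.
            \<Gamma> c' (transition c c' x) a b d * jac c c' x b i * jac c c' x d j))"

text \<open>\<open>cov_vec \<Gamma> v c x a b\<close> is the component \<open>v\<^sup>a\<^bsub>;b\<^esub>\<close>, and \<open>cov_tensor2 \<Gamma> h c x a b d\<close> is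
  \<open>h\<^bsub>ab;d\<^esub>\<close>: the last index is the index of differentiation.\<close>

definition cov_vec ::
    "('p, 'n::finite) conn \<Rightarrow> ('p, 'n) vfield \<Rightarrow> ('p, 'n) chart \<Rightarrow> real ^ 'n \<Rightarrow> 'n \<Rightarrow> 'n \<Rightarrow> real"
  where "cov_vec \<Gamma> v c x a b =
    partial b (\<lambda>y. v c y $ a) x + (\<Sum>d\<in>UNIV. \<Gamma> c x a b d * v c x $ d)"

definition cov_tensor2 ::
    "('p, 'n::finite) conn \<Rightarrow> ('p, 'n) tensor2 \<Rightarrow> ('p, 'n) chart \<Rightarrow> real ^ 'n
      \<Rightarrow> 'n \<Rightarrow> 'n \<Rightarrow> 'n \<Rightarrow> real"
  where "cov_tensor2 \<Gamma> h c x a b d =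
    partial d (\<lambda>y. h c y $ a $ b) x
      - (\<Sum>k\<in>UNIV. \<Gamma> c x k d a * h c x $ k $ b)
      - (\<Sum>k\<in>UNIV. \<Gamma> c x k d b * h c x $ a $ k)"

definition torsion_free :: "('p, 'n::finite) chart set \<Rightarrow> ('p, 'n) conn \<Rightarrow> bool"
  where "torsion_free A \<Gamma> \<longleftrightarrow>
    (\<forall>c\<in>A. \<forall>x\<in>chart_image c. \<forall>a b d. \<Gamma> c x a b d = \<Gamma> c x a d b)"

definition metric_compatible ::
    "('p, 'n::finite) chart set \<Rightarrow> ('p, 'n) tensor2 \<Rightarrow> ('p, 'n) conn \<Rightarrow> bool"
  where "metric_compatible A g \<Gamma> \<longleftrightarrow>
    (\<forall>c\<in>A. \<forall>x\<in>chart_image c. \<forall>a b d. cov_tensor2 \<Gamma> g c x a b d = 0)"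

definition levi_civita ::
    "('p, 'n::finite) chart set \<Rightarrow> ('p, 'n) tensor2 \<Rightarrow> ('p, 'n) conn \<Rightarrow> bool"
  where "levi_civita A g \<Gamma> \<longleftrightarrow>
    affine_connection A \<Gamma> \<and> torsion_free A \<Gamma> \<and> metric_compatible A g \<Gamma>"

text \<open>\<open>rel_Gamma \<Gamma> m c x a b d\<close> is \<open>\<Gamma>\<^sup>a\<^bsub>bd\<^esub>(g,m)\<close> when \<open>\<Gamma>\<close> is the Levi-Civita connection
  of \<open>g\<close>.\<close>

definition rel_Gamma ::
    "('p, 'n::finite) conn \<Rightarrow> ('p, 'n) tensor2 \<Rightarrow> ('p, 'n) chart \<Rightarrow> real ^ 'n
      \<Rightarrow> 'n \<Rightarrow> 'n \<Rightarrow> 'n \<Rightarrow> real"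
  where "rel_Gamma \<Gamma> m c x a b d =
    1/2 * (\<Sum>n\<in>UNIV. matrix_inv (m c x) $ a $ n *
      (cov_tensor2 \<Gamma> m c x n b d + cov_tensor2 \<Gamma> m c x n d b - cov_tensor2 \<Gamma> m c x b d n))"

end

theory Submission
  imports Defs
begin

text \<open>Let \<open>D\<close> be the difference of the two Levi-Civita connections. Since \<open>m\<close> is parallel for its
  own connection, \<open>m\<^bsub>ab;d\<^esub>(g)\<close> contains no derivatives of \<open>m\<close>: it equals \<open>T d a b + T d b a\<close>, where
  \<open>T d a b = D\<^sup>k\<^bsub>da\<^esub> m\<^bsub>kb\<^esub>\<close> is symmetric in \<open>d\<close> and \<open>a\<close>. The cyclic combination in the definition of
  \<open>\<Gamma>\<^sup>a\<^bsub>bd\<^esub>(g,m)\<close> therefore collapses to \<open>2 T d b n\<close>, and contraction with the inverse of \<open>m\<close> leaves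
  \<open>D\<^sup>a\<^bsub>bd\<^esub>\<close>.\<close>

text \<open>A kernel vector makes the quadratic form vanish, so by positivity it is zero; a square
  matrix with trivial kernel is invertible.\<close>

lemma pos_def_imp_invertible:
  fixes B :: "real ^ 'n::finite ^ 'n"
  assumes "\<And>u. u \<noteq> 0 \<Longrightarrow> (\<Sum>a\<in>UNIV. \<Sum>b\<in>UNIV. B $ a $ b * u $ a * u $ b) > 0"
  shows "invertible B"
proof -
  have "u = 0" if "B *v u = 0" for u
  proof (rule ccontr)
    assume "u \<noteq> 0"
    have "(\<Sum>a\<in>UNIV. \<Sum>b\<in>UNIV. B $ a $ b * u $ a * u $ b) = (\<Sum>a\<in>UNIV. u $ a * (B *v u) $ a)"
      by (simp add: matrix_vector_mult_def sum_distrib_left mult_ac)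
    also have "\<dots> = 0"
      using that by simp
    finally show False
      using assms[OF \<open>u \<noteq> 0\<close>] by simp
  qed
  then show ?thesis
    by (simp add: invertible_left_inverse matrix_left_invertible_ker)
qed

lemma matrix_inv_mult_left:
  fixes B :: "'a::semiring_1 ^ 'n ^ 'm"
  assumes "invertible B"
  shows "matrix_inv B ** B = mat 1"
  using someI_ex[OF assms[unfolded invertible_def]] by (simp add: matrix_inv_def)

text \<open>The partial derivative of \<open>h\<close> does not depend on the connection, so it
  cancels on subtracting the vanishing derivative for \<open>\<Gamma>'\<close>.\<close>

lemma cov_tensor2_parallel_diff:
  assumes "cov_tensor2 \<Gamma>' h c x a b d = 0"
  shows "cov_tensor2 \<Gamma> h c x a b d =
    (\<Sum>k\<in>UNIV. (\<Gamma>' c x k d a - \<Gamma> c x k d a) * h c x $ k $ b) +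
    (\<Sum>k\<in>UNIV. (\<Gamma>' c x k d b - \<Gamma> c x k d b) * h c x $ a $ k)"
  using assms by (simp add: cov_tensor2_def left_diff_distrib sum_subtractf)

lemma rel_Gamma_eq_diff:
  assumes parallel: "\<And>a b d. cov_tensor2 \<Gamma>' m c x a b d = 0"
    and tf: "\<And>a b d. \<Gamma> c x a b d = \<Gamma> c x a d b"
    and tf': "\<And>a b d. \<Gamma>' c x a b d = \<Gamma>' c x a d b"
    and sym: "\<And>a b. m c x $ a $ b = m c x $ b $ a"
    and inv: "invertible (m c x)"
  shows "rel_Gamma \<Gamma> m c x a b d = \<Gamma>' c x a b d - \<Gamma> c x a b d"
proof -
  define D where "D k i j = \<Gamma>' c x k i j - \<Gamma> c x k i j" for k i j
  define T where "T i j l = (\<Sum>k\<in>UNIV. D k i j * m c x $ k $ l)" for i j l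
  have D_sym: "D k i j = D k j i" for k i j
    by (simp add: D_def tf[of k i j] tf'[of k i j])
  have T_sym: "T i j l = T j i l" for i j l
    by (simp add: T_def D_sym[of _ i j])
  have cov: "cov_tensor2 \<Gamma> m c x i j l = T l i j + T l j i" for i j l
    by (simp add: cov_tensor2_parallel_diff[OF parallel] D_def T_def sym[of i])
  \<comment> \<open>Of the six terms, \<open>T d n b\<close> cancels \<open>T n d b\<close>,
    \<open>T b n d\<close> cancels \<open>T n b d\<close>, and \<open>T d b n\<close> doubles
    \<open>T b d n\<close>.\<close>
  have cyclic: "cov_tensor2 \<Gamma> m c x n b d + cov_tensor2 \<Gamma> m c x n d b - cov_tensor2 \<Gamma> m c x b d n
      = 2 * T b d n" for n
    using T_sym[of d n b] T_sym[of d b n] T_sym[of b n d] by (simp add: cov)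
  \<comment> \<open>Symmetry of \<open>m\<close> turns its row \<open>k\<close> into a column, so
    the sum is an entry of the product of the inverse with \<open>m\<close>.\<close>
  have delta: "(\<Sum>n\<in>UNIV. matrix_inv (m c x) $ a $ n * m c x $ k $ n) = (if a = k then 1 else 0)" for k
  proof -
    have "(\<Sum>n\<in>UNIV. matrix_inv (m c x) $ a $ n * m c x $ k $ n) = (matrix_inv (m c x) ** m c x) $ a $ k"
      by (simp add: matrix_matrix_mult_def sym[of k])
    then show ?thesis
      by (simp add: matrix_inv_mult_left[OF inv] mat_def)
  qed
  have "rel_Gamma \<Gamma> m c x a b d = (\<Sum>n\<in>UNIV. matrix_inv (m c x) $ a $ n * T b d n)"
    unfolding rel_Gamma_def cyclic by (simp add: sum_distrib_left)
  also have "\<dots> = (\<Sum>n\<in>UNIV. \<Sum>k\<in>UNIV. D k b d * (matrix_inv (m c x) $ a $ n * m c x $ k $ n))"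
    by (simp add: T_def sum_distrib_left mult_ac)
  also have "\<dots> = (\<Sum>k\<in>UNIV. D k b d * (\<Sum>n\<in>UNIV. matrix_inv (m c x) $ a $ n * m c x $ k $ n))"
    by (subst sum.swap) (simp add: sum_distrib_left)
  also have "\<dots> = (\<Sum>k\<in>UNIV. if a = k then D k b d else 0)"
    unfolding delta by (rule sum.cong) auto
  also have "\<dots> = D a b d"
    by simp
  finally show ?thesis
    by (simp add: D_def)
qed

theorem theorem3p1:
  fixes M :: "'p topology"
    and A :: "('p, 'n::finite) chart set"
    and g m :: "('p, 'n) tensor2"
    and \<Gamma>g \<Gamma>m :: "('p, 'n) conn"
    and v :: "('p, 'n) vfield"
  assumes "smooth_manifold M A"
    and "riemannian_metric A g" and "riemannian_metric A m"
    and "levi_civita A g \<Gamma>g" and "levi_civita A m \<Gamma>m"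
    and "smooth_vector_field A v"
  shows "\<forall>c\<in>A. \<forall>x\<in>chart_image c. \<forall>a b.
    cov_vec \<Gamma>m v c x a b =
      cov_vec \<Gamma>g v c x a b + (\<Sum>d\<in>UNIV. rel_Gamma \<Gamma>g m c x a d b * v c x $ d)"
proof (intro ballI allI)
  fix c x a b
  assume "c \<in> A" "x \<in> chart_image c"
  then have tf_g: "\<And>a b d. \<Gamma>g c x a b d = \<Gamma>g c x a d b"
    and tf_m: "\<And>a b d. \<Gamma>m c x a b d = \<Gamma>m c x a d b"
    and parallel: "\<And>a b d. cov_tensor2 \<Gamma>m m c x a b d = 0"
    and sym: "\<And>a b. m c x $ a $ b = m c x $ b $ a"
    and pos: "\<And>u. u \<noteq> 0 \<Longrightarrow> (\<Sum>a\<in>UNIV. \<Sum>b\<in>UNIV. m c x $ a $ b * u $ a * u $ b) > 0"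
    using assms(3-5)
    by (simp_all add: levi_civita_def torsion_free_def metric_compatible_def riemannian_metric_def)
  have inv: "invertible (m c x)"
    using pos by (rule pos_def_imp_invertible)
  \<comment> \<open>The theorem contracts \<open>v\<close> with the first lower index of
    \<open>rel_Gamma\<close>, but \<open>cov_vec\<close> with the second lower index of the
    connection; torsion-freeness reconciles the two.\<close>
  have rel: "rel_Gamma \<Gamma>g m c x a d b = \<Gamma>m c x a b d - \<Gamma>g c x a b d" for d
  proof -
    have "rel_Gamma \<Gamma>g m c x a d b = \<Gamma>m c x a d b - \<Gamma>g c x a d b"
      by (rule rel_Gamma_eq_diff) (fact parallel tf_g tf_m sym inv)+
    then show ?thesis
      by (simp add: tf_g[of a d b] tf_m[of a d b])
  qed
  show "cov_vec \<Gamma>m v c x a b =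
      cov_vec \<Gamma>g v c x a b + (\<Sum>d\<in>UNIV. rel_Gamma \<Gamma>g m c x a d b * v c x $ d)"
    by (simp add: cov_vec_def rel left_diff_distrib sum_subtractf)
qed

end
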